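(* For every $x\in(0,\infty)$, the gamma function satisfies $$\sqrt{2\pi}\,\Bigl(\frac{x+1/2}{e}\Bigr)^{x+1/2}\exp\Bigl(-\frac1{24(x+1/2)}\Bigr)<\Gamma(x+1)<\sqrt{2\pi}\,\Bigl(\frac{x+1/2}{e}\Bigr)^{x+1/2}\exp\Bigl(\frac1{24}\Bigl(\frac{2x}{x+1/2}-12(\ln\pi-1)\Bigr)\Bigr)$$ and $$\sqrt{2\pi}\,\Bigl(\frac{x+1/2}{e}\Bigr)^{x+1/2}\exp\Bigl(\frac1{24}\Bigl[\frac{2x}{3(x+3/2)}-12(\ln\pi-1)\Bigr]\Bigr)<\Gamma(x+1)<\sqrt{2\pi}\,\Bigl(\frac{x+1/2}{e}\Bigr)^{x+1/2}\exp\Bigl(-\frac1{24(x+3/2)}\Bigr).$$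
   Context: $\Gamma(x)=\int_0^\infty t^{x-1}e^{-t}\,dt$ for $x>0$ is the classical Euler gamma function. *)

theory Defs
  imports "HOL-Analysis.Analysis"
begin

text \<open>
  The library's \<^const>\<open>Gamma\<close> is the Euler gamma function: its integral representation
  on the positive reals is the library fact \<open>Gamma_integral_real\<close>.
\<close>

end

theory Submission
  imports Defs "HOL-Real_Asymp.Real_Asymp"
begin

text \<open>
  Write \<open>y = x + 1/2\<close>. Taking logarithms, all four inequalities are bounds on the error
  \<open>r y = ln \<Gamma>(y + 1/2) - (y ln y - y) - ln (2\<pi>) / 2\<close> of Stirling's approximation centred at the
  half-shifted argument (\<open>stirling_error\<close> below), and all four come from the single two-sided estimate
  \<open>1 / (24 (y + 1)\<^sup>2) < r' y < 1 / (24 y\<^sup>2)\<close>, where \<open>r' y = \<psi>(y + 1/2) - ln y\<close> and \<open>\<psi>\<close> is the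
  digamma function. Integrating the estimate from \<open>y\<close> to \<open>\<infinity>\<close>, where \<open>r\<close> vanishes, gives
  \<open>-1 / (24 y) < r y < -1 / (24 (y + 1))\<close>; integrating it from \<open>1/2\<close> to \<open>y\<close>, with
  \<open>r (1/2) = (1 - ln \<pi>) / 2\<close>, gives the two bounds that contain \<open>ln \<pi>\<close>.

  The derivative estimate is proved by telescoping. Since \<open>\<psi>(z + 1) = \<psi>(z) + 1/z\<close>, the step
  from \<open>y\<close> to \<open>y + 1\<close> changes \<open>r' y - h y\<close> by an elementary function, whose sign for
  \<open>h y = 1 / (24 y\<^sup>2)\<close> and for \<open>h y = 1 / (24 (y + 1)\<^sup>2)\<close> is decided by differentiating once:
  it vanishes at infinity and its derivative is rational of constant sign.
  As \<open>r' (y + n) - h (y + n)\<close> tends to \<open>0\<close>, the sign of the steps decides that of \<open>r' y - h y\<close>.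

  That \<open>r\<close> tends to \<open>0\<close> (Stirling's formula, including the constant) also follows from the derivative
  estimate: it bounds the increments of \<open>r\<close> beyond \<open>y\<close> by \<open>1 / (24 y)\<close>, and Legendre's duplication
  formula expresses \<open>r y\<close> as such an increment plus an elementary function that tends to \<open>0\<close>.
\<close>

section \<open>Bounds for the digamma function\<close>

text \<open>
  Both terms differ from \<open>ln n\<close> by a null sequence: the digamma value by Euler's limit for \<open>\<psi>\<close>, since the
  functional equation turns \<open>\<psi>(y + n + 1/2)\<close> into \<open>\<psi>(y + 1/2)\<close> plus a partial sum of that limit.
\<close>

lemma Digamma_minus_ln_shift_LIMSEQ:
  fixes y :: real
  assumes "y > 0"
  shows "(\<lambda>n. Digamma (y + real n + 1/2) - ln (y + real n)) \<longlonglongrightarrow> 0"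
proof -
  let ?z = "y + 1/2"
  have shift: "Digamma (?z + real n) = Digamma ?z + (\<Sum>k<n. inverse (?z + real k))" for n
  proof (induction n)
    case (Suc n)
    have "Digamma (?z + real n + 1) = Digamma (?z + real n) + 1 / (?z + real n)"
      using assms by (intro Digamma_plus1) auto
    with Suc show ?case by (simp add: add_ac inverse_eq_divide)
  qed simp
  have "(\<lambda>n. ln (real n) - (\<Sum>k<n. inverse (?z + real k))) \<longlonglongrightarrow> Digamma ?z"
    using Digamma_LIMSEQ[of ?z] assms by simp
  hence "(\<lambda>n. Digamma ?z - (ln (real n) - (\<Sum>k<n. inverse (?z + real k)))) \<longlonglongrightarrow> Digamma ?z - Digamma ?z"
    by (intro tendsto_intros)
  moreover have "(\<lambda>n. ln (real n) - ln (y + real n)) \<longlonglongrightarrow> 0"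
    by real_asymp
  ultimately have "(\<lambda>n. (Digamma ?z - (ln (real n) - (\<Sum>k<n. inverse (?z + real k))))
                     + (ln (real n) - ln (y + real n))) \<longlonglongrightarrow> (Digamma ?z - Digamma ?z) + 0"
    by (intro tendsto_add)
  moreover have "Digamma (y + real n + 1/2) = Digamma ?z + (\<Sum>k<n. inverse (?z + real k))" for n
    using shift[of n] by (simp add: add_ac)
  ultimately show ?thesis by (simp add: algebra_simps)
qed

text \<open>
  The telescoping principle: it turns a comparison of \<open>f t\<close> with \<open>f (t + 1)\<close>, in which the digamma
  function cancels, into a bound on \<open>f\<close> itself.
\<close>

lemma neg_if_unit_steps_increase_to_0:
  fixes f :: "real \<Rightarrow> real"
  assumes step: "\<And>t. t \<ge> y \<Longrightarrow> f t < f (t + 1)"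
    and lim: "(\<lambda>n. f (y + real n)) \<longlonglongrightarrow> 0"
  shows "f y < 0"
proof -
  have "incseq (\<lambda>n. f (y + real n))"
  proof (rule incseq_SucI)
    fix n show "f (y + real n) \<le> f (y + real (Suc n))"
      using step[of "y + real n"] by (simp add: add_ac)
  qed
  hence "f (y + real 1) \<le> 0" using lim by (rule incseq_le)
  thus ?thesis using step[of y] by simp
qed

text \<open>
  The next two identities write the derivatives of the step functions in terms of \<open>t (t + 1)\<close>; the
  midpoint satisfies \<open>(t + 1/2)\<^sup>2 = t (t + 1) + 1/4\<close>.
\<close>

lemma inverse_step_minus_midpoint_square:
  fixes t :: real
  assumes "t > 0" and p: "p = t * (t + 1)"
  shows "1 / t - 1 / (t + 1) - 1 / (t + 1/2)\<^sup>2 = 1 / (4 * p * (p + 1/4))"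
proof -
  have p_pos: "p > 0" using assms by simp
  have "(t + 1/2)\<^sup>2 = p + 1/4" by (simp add: p power2_eq_square algebra_simps)
  moreover have "1 / t - 1 / (t + 1) = 1 / p" using assms by (simp add: field_simps)
  moreover have "1 / p - 1 / (p + 1/4) = ((p + 1/4) - p) / (p * (p + 1/4))"
    using p_pos by (subst diff_frac_eq) auto
  ultimately show ?thesis by simp
qed

lemma inverse_cube_step:
  fixes t :: real
  assumes "t > 0" and p: "p = t * (t + 1)"
  shows "1 / (12 * t^3) - 1 / (12 * (t + 1)^3) = (3 * p + 1) / (12 * p^3)"
proof -
  have "(t + 1)^3 - t^3 = 3 * p + 1" by (simp add: p power3_eq_cube algebra_simps)
  moreover have "1 / (12 * t^3) - 1 / (12 * (t + 1)^3) = ((t + 1)^3 - t^3) / (12 * p^3)"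
    using assms by (simp add: power_mult_distrib divide_simps)
  ultimately show ?thesis by simp
qed

text \<open>
  In terms of \<open>p = y (y + 1)\<close> the derivative of the function bounded here is
  \<open>1 / (4 p (p + 1/4)) - (3 p + 1) / (12 p\<^sup>3)\<close>, which is negative, so the function decreases to its
  limit \<open>0\<close>.
\<close>

lemma Digamma_upper_step:
  fixes y :: real
  assumes "y > 0"
  shows "0 < 1 / (y + 1/2) - ln (y + 1) + ln y + 1 / (24 * y\<^sup>2) - 1 / (24 * (y + 1)\<^sup>2)"
proof -
  define U where "U = (\<lambda>y::real. 1 / (y + 1/2) - ln (y + 1) + ln y + 1 / (24 * y\<^sup>2) - 1 / (24 * (y + 1)\<^sup>2))"
  have "\<exists>d. (U has_real_derivative d) (at t) \<and> d < 0" if "t \<ge> y" for t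
  proof -
    have t: "t > 0" using that assms by simp
    define p where "p = t * (t + 1)"
    have p: "p > 0" using t by (simp add: p_def)
    have "(U has_real_derivative 1 / t - 1 / (t + 1) - 1 / (t + 1/2)\<^sup>2 - 1 / (12 * t^3) + 1 / (12 * (t + 1)^3)) (at t)"
      unfolding U_def using t
      by (auto intro!: derivative_eq_intros simp: power2_eq_square power3_eq_cube)
         (simp add: divide_simps, simp add: algebra_simps)
    moreover note inverse_step_minus_midpoint_square[OF t p_def] inverse_cube_step[OF t p_def]
    moreover have "1 / (4 * p * (p + 1/4)) < (3 * p + 1) / (12 * p^3)"
    proof -
      have "3 * p^2 < (3 * p + 1) * (p + 1/4)"
        using p by (simp add: power2_eq_square algebra_simps)
      hence "3 * p^2 / (12 * p^3 * (p + 1/4)) < (3 * p + 1) * (p + 1/4) / (12 * p^3 * (p + 1/4))"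
        using p by (intro divide_strict_right_mono) auto
      also have "\<dots> = (3 * p + 1) / (12 * p^3)" using p by simp
      also have "3 * p^2 / (12 * p^3 * (p + 1/4)) = 1 / (4 * p * (p + 1/4))"
        using p by (simp add: power2_eq_square power3_eq_cube)
      finally show ?thesis .
    qed
    ultimately show ?thesis by (intro exI conjI) (assumption, linarith)
  qed
  moreover have "(U \<longlongrightarrow> 0) at_top"
    unfolding U_def by real_asymp
  ultimately have "0 < U y" by (rule DERIV_neg_imp_decreasing_at_top)
  thus ?thesis by (simp add: U_def)
qed

text \<open>
  Here the function increases to its limit \<open>0\<close>: with \<open>p = y (y + 1)\<close> and \<open>q = (y + 1) (y + 2)\<close> its
  derivative is \<open>1 / (4 p (p + 1/4)) - (3 q + 1) / (12 q\<^sup>3)\<close>, which is positive because \<open>q > p + 1\<close>.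
\<close>

lemma Digamma_lower_step:
  fixes y :: real
  assumes "y > 0"
  shows "1 / (y + 1/2) - ln (y + 1) + ln y + 1 / (24 * (y + 1)\<^sup>2) - 1 / (24 * (y + 2)\<^sup>2) < 0"
proof -
  \<comment> \<open>The sign is reversed so that \<open>L\<close> decreases to \<open>0\<close>.\<close>
  define L where "L = (\<lambda>y::real. - (1 / (y + 1/2) - ln (y + 1) + ln y + 1 / (24 * (y + 1)\<^sup>2) - 1 / (24 * (y + 2)\<^sup>2)))"
  have "\<exists>d. (L has_real_derivative d) (at t) \<and> d < 0" if "t \<ge> y" for t
  proof -
    have t: "t > 0" using that assms by simp
    define p where "p = t * (t + 1)"
    define q where "q = (t + 1) * (t + 2)"
    have p: "p > 0" using t by (simp add: p_def)
    have pq: "p + 1 < q" using t by (simp add: p_def q_def algebra_simps)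
    have q: "q > 0" using p pq by simp
    have "(L has_real_derivative - (1 / t - 1 / (t + 1) - 1 / (t + 1/2)\<^sup>2 - 1 / (12 * (t + 1)^3) + 1 / (12 * (t + 2)^3))) (at t)"
      unfolding L_def using t
      by (auto intro!: derivative_eq_intros simp: power2_eq_square power3_eq_cube)
         (simp add: divide_simps, simp add: algebra_simps)
    moreover note inverse_step_minus_midpoint_square[OF t p_def]
    moreover have "1 / (12 * (t + 1)^3) - 1 / (12 * (t + 2)^3) = (3 * q + 1) / (12 * q^3)"
      using inverse_cube_step[of "t + 1" q] t by (simp add: q_def add_ac)
    moreover have "(3 * q + 1) / (12 * q^3) < 1 / (4 * p * (p + 1/4))"
    proof -
      have "4 * p * (p + 1/4) < 4 * ((q - 1) * (q - 3/4))"
        using p pq by (simp add: mult.assoc) (intro mult_strict_mono; simp)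
      moreover have "(3 * q + 1) * (4 * ((q - 1) * (q - 3/4))) < 12 * q^3"
      proof -
        have "12 * q^3 - (3 * q + 1) * (4 * ((q - 1) * (q - 3/4))) = 17 * q^2 - 2 * q - 3"
          by (simp add: power2_eq_square power3_eq_cube field_simps)
        moreover have "q < q^2" using p pq by (simp add: power2_eq_square)
        ultimately show ?thesis using p pq by linarith
      qed
      ultimately have "(3 * q + 1) * (4 * p * (p + 1/4)) < 12 * q^3"
        using q by (smt (verit) mult_strict_left_mono)
      thus ?thesis using p q by (simp add: divide_less_eq less_divide_eq mult_ac)
    qed
    ultimately show ?thesis by (intro exI conjI) (assumption, linarith)
  qed
  moreover have "(L \<longlongrightarrow> 0) at_top"
    unfolding L_def by real_asymp
  ultimately have "0 < L y" by (rule DERIV_neg_imp_decreasing_at_top)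
  thus ?thesis by (simp add: L_def)
qed

lemma Digamma_half_shift_upper:
  fixes y :: real
  assumes "y > 0"
  shows "Digamma (y + 1/2) - ln y < 1 / (24 * y\<^sup>2)"
proof -
  define f where "f = (\<lambda>t::real. Digamma (t + 1/2) - ln t - 1 / (24 * t\<^sup>2))"
  have "f y < 0"
  proof (rule neg_if_unit_steps_increase_to_0[where f = f and y = y])
    fix t assume "t \<ge> y"
    hence t: "t > 0" using assms by simp
    have "Digamma (t + 1/2 + 1) = Digamma (t + 1/2) + 1 / (t + 1/2)"
      using t by (intro Digamma_plus1) simp
    moreover have "t + 1 + 1/2 = t + 1/2 + 1" by simp
    ultimately show "f t < f (t + 1)"
      unfolding f_def using Digamma_upper_step[OF t] by (simp only:)
  next
    have "(\<lambda>n. 1 / (24 * (y + real n)\<^sup>2)) \<longlonglongrightarrow> 0" by real_asymp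
    from tendsto_diff[OF Digamma_minus_ln_shift_LIMSEQ[OF assms] this]
    show "(\<lambda>n. f (y + real n)) \<longlonglongrightarrow> 0" by (simp add: f_def)
  qed
  thus ?thesis by (simp add: f_def)
qed

lemma Digamma_half_shift_lower:
  fixes y :: real
  assumes "y > 0"
  shows "1 / (24 * (y + 1)\<^sup>2) < Digamma (y + 1/2) - ln y"
proof -
  define f where "f = (\<lambda>t::real. 1 / (24 * (t + 1)\<^sup>2) - (Digamma (t + 1/2) - ln t))"
  have "f y < 0"
  proof (rule neg_if_unit_steps_increase_to_0[where f = f and y = y])
    fix t assume "t \<ge> y"
    hence t: "t > 0" using assms by simp
    have "Digamma (t + 1/2 + 1) = Digamma (t + 1/2) + 1 / (t + 1/2)"
      using t by (intro Digamma_plus1) simp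
    moreover have "t + 1 + 1/2 = t + 1/2 + 1" "t + 1 + 1 = t + 2" by simp_all
    ultimately show "f t < f (t + 1)"
      unfolding f_def using Digamma_lower_step[OF t] by (simp only:)
  next
    have "(\<lambda>n. 1 / (24 * (y + real n + 1)\<^sup>2)) \<longlonglongrightarrow> 0" by real_asymp
    from tendsto_diff[OF this Digamma_minus_ln_shift_LIMSEQ[OF assms]]
    show "(\<lambda>n. f (y + real n)) \<longlonglongrightarrow> 0" by (simp add: f_def)
  qed
  thus ?thesis by (simp add: f_def)
qed

section \<open>The error in Stirling's approximation\<close>

text \<open>
  Evaluating \<open>\<Gamma>\<close> at \<open>y + 1/2\<close> instead of \<open>y\<close> absorbs the term \<open>- ln y / 2\<close> of the usual Stirling
  formula for \<open>ln \<Gamma>(y)\<close>, so only \<open>y ln y - y\<close> and a constant are subtracted.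
\<close>

definition stirling_error :: "real \<Rightarrow> real" where
  "stirling_error y = ln_Gamma (y + 1/2) - (y * ln y - y) - ln (2 * pi) / 2"

lemma Gamma_half_shift_eq:
  assumes "y > 0"
  shows "Gamma (y + 1/2) = sqrt (2 * pi) * (y / exp 1) powr y * exp (stirling_error y)"
proof -
  have "exp (ln (2 * pi) / 2) = exp (ln (sqrt (2 * pi)))"
    by (subst ln_sqrt) simp_all
  also have "\<dots> = sqrt (2 * pi)"
    by (rule exp_ln) simp
  finally have "sqrt (2 * pi) = exp (ln (2 * pi) / 2)" ..
  moreover have "(y / exp 1) powr y = exp (y * ln y - y)"
    using assms by (simp add: powr_def ln_div algebra_simps)
  moreover have "Gamma (y + 1/2) = exp (ln_Gamma (y + 1/2))"
    using assms by (intro Gamma_real_pos_exp) simp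
  ultimately show ?thesis
    by (simp add: stirling_error_def flip: exp_add)
qed

lemma has_real_derivative_stirling_error:
  assumes "y > 0"
  shows "(stirling_error has_real_derivative Digamma (y + 1/2) - ln y) (at y)"
  unfolding stirling_error_def using assms
  by (auto intro!: derivative_eq_intros)

text \<open>
  Subtracting an antiderivative of the bound from the error leaves a strictly monotone function. Monotonicity
  up to infinity keeps the inequalities strict, which passing to the limit in the increment bounds
  would not.
\<close>

lemma stirling_error_upper_compensated_deriv_neg:
  assumes "t > 0"
  shows "\<exists>d. ((\<lambda>t. stirling_error t + 1 / (24 * t)) has_real_derivative d) (at t) \<and> d < 0"
proof -
  have "((\<lambda>t. stirling_error t + 1 / (24 * t)) has_real_derivative
           (Digamma (t + 1/2) - ln t) - 1 / (24 * t\<^sup>2)) (at t)"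
    using assms
    by (auto intro!: derivative_eq_intros has_real_derivative_stirling_error simp: power2_eq_square)
  with Digamma_half_shift_upper[OF assms] show ?thesis by auto
qed

lemma stirling_error_lower_compensated_deriv_neg:
  assumes "t > 0"
  shows "\<exists>d. ((\<lambda>t. - (stirling_error t + 1 / (24 * (t + 1)))) has_real_derivative d) (at t) \<and> d < 0"
proof -
  have "((\<lambda>t. - (stirling_error t + 1 / (24 * (t + 1)))) has_real_derivative
           - ((Digamma (t + 1/2) - ln t) - 1 / (24 * (t + 1)\<^sup>2))) (at t)"
    using assms
    by (auto intro!: derivative_eq_intros has_real_derivative_stirling_error simp: power2_eq_square)
       (simp add: divide_simps, simp add: algebra_simps)
  with Digamma_half_shift_lower[OF assms] show ?thesis by auto
qed

lemma stirling_error_increment_less: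
  assumes "0 < y" "y < z"
  shows "stirling_error z - stirling_error y < 1 / (24 * y) - 1 / (24 * z)"
  using DERIV_neg_imp_decreasing[OF assms(2) stirling_error_upper_compensated_deriv_neg] assms(1)
  by simp

lemma stirling_error_increment_greater:
  assumes "0 < y" "y < z"
  shows "1 / (24 * (y + 1)) - 1 / (24 * (z + 1)) < stirling_error z - stirling_error y"
  using DERIV_neg_imp_decreasing[OF assms(2) stirling_error_lower_compensated_deriv_neg] assms(1)
  by simp

lemma ln_Gamma_legendre_duplication:
  fixes y :: real
  assumes "y > 0"
  shows "ln_Gamma y + ln_Gamma (y + 1/2) = (1 - 2 * y) * ln 2 + ln pi / 2 + ln_Gamma (2 * y)"
proof -
  have "complex_of_real y \<notin> \<int>\<^sub>\<le>\<^sub>0"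
    using assms by (auto simp: of_real_in_nonpos_Ints_iff)
  moreover have "complex_of_real (y + 1/2) \<notin> \<int>\<^sub>\<le>\<^sub>0"
    unfolding of_real_in_nonpos_Ints_iff using assms by auto
  ultimately have "Gamma (complex_of_real y) * Gamma (complex_of_real y + 1/2) =
      exp ((1 - 2 * complex_of_real y) * of_real (ln 2)) * of_real (sqrt pi) * Gamma (2 * complex_of_real y)"
    by (intro Gamma_legendre_duplication) simp_all
  also have "Gamma (complex_of_real y) * Gamma (complex_of_real y + 1/2) = of_real (Gamma y * Gamma (y + 1/2))"
    by (simp flip: Gamma_complex_of_real)
  also have "exp ((1 - 2 * complex_of_real y) * of_real (ln 2)) * of_real (sqrt pi) * Gamma (2 * complex_of_real y)
      = of_real (exp ((1 - 2 * y) * ln 2) * sqrt pi * Gamma (2 * y))"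
    by (simp flip: Gamma_complex_of_real exp_of_real)
  finally have "Gamma y * Gamma (y + 1/2) = exp ((1 - 2 * y) * ln 2) * sqrt pi * Gamma (2 * y)"
    unfolding of_real_eq_iff .
  hence "ln (Gamma y * Gamma (y + 1/2)) = ln (exp ((1 - 2 * y) * ln 2) * sqrt pi * Gamma (2 * y))"
    by simp
  moreover have "Gamma y > 0" "Gamma (y + 1/2) > 0" "Gamma (2 * y) > 0"
    using assms by simp_all
  ultimately show ?thesis
    using assms by (simp add: ln_Gamma_real_pos ln_mult_pos ln_sqrt)
qed

text \<open>
  Stirling's formula. Legendre's duplication formula at \<open>y + 1/2\<close> gives
  \<open>r y = (r (2 y + 1/2) - r (y + 1/2)) + e y\<close> with \<open>e\<close> elementary. The increment in brackets is between
  \<open>0\<close> and \<open>1 / (24 (y + 1/2))\<close>, and \<open>e y\<close> tends to \<open>0\<close> exactly because the constant in \<open>r\<close> is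
  \<open>ln (2\<pi>) / 2\<close>.
\<close>

lemma stirling_error_tendsto_0: "(stirling_error \<longlongrightarrow> 0) at_top"
proof -
  define d where "d = (\<lambda>y. stirling_error (2 * y + 1/2) - stirling_error (y + 1/2))"
  define e where "e = (\<lambda>y::real. - (2 * y * ln 2) - ln 2 / 2
    + (2 * y + 1/2) * ln (2 * y + 1/2) - y * ln y - (y + 1/2) * ln (y + 1/2))"
  have "(d \<longlongrightarrow> 0) at_top"
  proof (rule tendsto_sandwich)
    show "\<forall>\<^sub>F y in at_top. 0 \<le> d y"
      using eventually_gt_at_top[of 0]
    proof eventually_elim
      case (elim y)
      have "0 \<le> 1 / (24 * (y + 1/2 + 1)) - 1 / (24 * (2 * y + 1/2 + 1))"
        using elim by (simp add: frac_le)
      also have "\<dots> < d y"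
        unfolding d_def using elim by (intro stirling_error_increment_greater) auto
      finally show ?case by simp
    qed
    show "\<forall>\<^sub>F y in at_top. d y \<le> 1 / (24 * (y + 1/2))"
      using eventually_gt_at_top[of 0]
    proof eventually_elim
      case (elim y)
      have "d y < 1 / (24 * (y + 1/2)) - 1 / (24 * (2 * y + 1/2))"
        unfolding d_def using elim by (intro stirling_error_increment_less) auto
      also have "\<dots> \<le> 1 / (24 * (y + 1/2))" using elim by simp
      finally show ?case by simp
    qed
    show "((\<lambda>y::real. 1 / (24 * (y + 1/2))) \<longlongrightarrow> 0) at_top" by real_asymp
  qed simp
  moreover have "(e \<longlongrightarrow> 0) at_top"
    unfolding e_def by real_asymp
  ultimately have lim: "((\<lambda>y. d y + e y) \<longlongrightarrow> 0 + 0) at_top"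
    by (rule tendsto_add)
  have "\<forall>\<^sub>F y in at_top. d y + e y = stirling_error y"
    using eventually_gt_at_top[of 0]
  proof eventually_elim
    case (elim y)
    have "ln_Gamma (y + 1/2) + ln_Gamma (y + 1/2 + 1/2)
        = (1 - 2 * (y + 1/2)) * ln 2 + ln pi / 2 + ln_Gamma (2 * (y + 1/2))"
      using elim by (intro ln_Gamma_legendre_duplication) simp
    moreover have "2 * (y + 1/2) = 2 * y + 1/2 + 1/2" by simp
    ultimately have "ln_Gamma (y + 1/2) + ln_Gamma (y + 1/2 + 1/2)
        = - (2 * y * ln 2) + ln pi / 2 + ln_Gamma (2 * y + 1/2 + 1/2)"
      by (simp only:) (simp add: algebra_simps)
    moreover have "ln (2 * pi) = ln 2 + ln pi" by (simp add: ln_mult)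
    ultimately show ?case
      unfolding d_def e_def stirling_error_def by (simp only:) (simp add: field_simps)
  qed
  with lim show ?thesis by (auto intro: Lim_transform_eventually)
qed

lemma stirling_error_greater:
  assumes "y > 0"
  shows "- (1 / (24 * y)) < stirling_error y"
proof -
  have "((\<lambda>t. stirling_error t + 1 / (24 * t)) \<longlongrightarrow> 0 + 0) at_top"
    by (intro tendsto_add stirling_error_tendsto_0) real_asymp
  with assms have "0 + 0 < stirling_error y + 1 / (24 * y)"
    by (intro DERIV_neg_imp_decreasing_at_top[where f = "\<lambda>t. stirling_error t + 1 / (24 * t)"]
          stirling_error_upper_compensated_deriv_neg) auto
  thus ?thesis by simp
qed

lemma stirling_error_less:
  assumes "y > 0"
  shows "stirling_error y < - (1 / (24 * (y + 1)))"
proof -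
  have "((\<lambda>t. - (stirling_error t + 1 / (24 * (t + 1)))) \<longlongrightarrow> - (0 + 0)) at_top"
    by (intro tendsto_minus tendsto_add stirling_error_tendsto_0) real_asymp
  with assms have "- (0 + 0) < - (stirling_error y + 1 / (24 * (y + 1)))"
    by (intro DERIV_neg_imp_decreasing_at_top[where f = "\<lambda>t. - (stirling_error t + 1 / (24 * (t + 1)))"]
          stirling_error_lower_compensated_deriv_neg) auto
  thus ?thesis by simp
qed

text \<open>The value at \<open>y = 1/2\<close>, where \<open>\<Gamma>(y + 1/2) = \<Gamma>(1) = 1\<close>, is the source of the terms with \<open>ln \<pi>\<close>.\<close>

lemma stirling_error_one_half: "stirling_error (1/2) = (1 - ln pi) / 2"
proof -
  have "ln_Gamma (1/2 + 1/2 :: real) = 0" by (simp add: ln_Gamma_real_pos)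
  moreover have "ln (1/2 :: real) = - ln 2" by (simp add: ln_div)
  moreover have "ln (2 * pi) = ln 2 + ln pi" by (simp add: ln_mult)
  ultimately show ?thesis unfolding stirling_error_def by (simp only:) (simp add: field_simps)
qed

section \<open>Bounds for the gamma function\<close>

theorem theorem2:
  fixes x :: real
  assumes "x \<in> {0<..}"
  shows "sqrt (2 * pi) * ((x + 1/2) / exp 1) powr (x + 1/2) * exp (- (1 / (24 * (x + 1/2))))
           < Gamma (x + 1)
       \<and> Gamma (x + 1)
           < sqrt (2 * pi) * ((x + 1/2) / exp 1) powr (x + 1/2)
             * exp (1/24 * (2 * x / (x + 1/2) - 12 * (ln pi - 1)))
       \<and> sqrt (2 * pi) * ((x + 1/2) / exp 1) powr (x + 1/2)
             * exp (1/24 * (2 * x / (3 * (x + 3/2)) - 12 * (ln pi - 1)))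
           < Gamma (x + 1)
       \<and> Gamma (x + 1)
           < sqrt (2 * pi) * ((x + 1/2) / exp 1) powr (x + 1/2) * exp (- (1 / (24 * (x + 3/2))))"
proof -
  have x: "x > 0" using assms by simp
  define y where "y = x + 1/2"
  have y: "y > 0" "1/2 < y" using x by (simp_all add: y_def)
  let ?C = "sqrt (2 * pi) * (y / exp 1) powr y"
  have C: "?C > 0" using y by simp
  have Gamma: "Gamma (x + 1) = ?C * exp (stirling_error y)"
    using Gamma_half_shift_eq[OF y(1)] by (simp add: y_def add_ac)
  have lower: "- (1 / (24 * (x + 1/2))) < stirling_error y"
    using stirling_error_greater[OF y(1)] by (simp add: y_def)
  have upper: "stirling_error y < - (1 / (24 * (x + 3/2)))"
    using stirling_error_less[OF y(1)] by (simp add: y_def add_ac)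
  \<comment> \<open>The bounds containing \<open>ln \<pi>\<close> are the increment bounds on the interval from \<open>1/2\<close> to \<open>y\<close>.\<close>
  have "1/24 * (2 * x / (x + 1/2) - 12 * (ln pi - 1))
      = stirling_error (1/2) + (1 / (24 * (1/2)) - 1 / (24 * y))"
    using x by (simp add: stirling_error_one_half y_def divide_simps) (simp add: algebra_simps)
  with stirling_error_increment_less[OF _ y(2)]
  have upper_pi: "stirling_error y < 1/24 * (2 * x / (x + 1/2) - 12 * (ln pi - 1))"
    by simp
  have "1/24 * (2 * x / (3 * (x + 3/2)) - 12 * (ln pi - 1))
      = stirling_error (1/2) + (1 / (24 * (1/2 + 1)) - 1 / (24 * (y + 1)))"
    using x by (simp add: stirling_error_one_half y_def divide_simps) (simp add: algebra_simps)
  with stirling_error_increment_greater[OF _ y(2)]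
  have lower_pi: "1/24 * (2 * x / (3 * (x + 3/2)) - 12 * (ln pi - 1)) < stirling_error y"
    by simp
  have less: "?C * exp a < ?C * exp b" if "a < b" for a b
    using that C by (intro mult_strict_left_mono) auto
  show ?thesis
    unfolding Gamma y_def[symmetric]
    using less[OF lower] less[OF upper_pi] less[OF lower_pi] less[OF upper]
    by (simp only: y_def)
qed

end
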